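(* Let $(X,\tau,\mathfrak{M},\mu)$ be a topological measure space. Then the following statements are equivalent. (1) The topological measure space $(X,\tau,\mathfrak{M},\mu)$ is almost normal and $\mu$ is strongly regular. (2) The strong Lusin theorem holds, i.e., for every measurable function $u:X\to\overline{\mathbb{R}}$ and any $\varepsilon\in(0,\infty)$, there exist a closed set $C_\varepsilon\subseteq X$ and a continuous function $g:X\to\overline{\mathbb{R}}$ such that $\mu(X\setminus C_\varepsilon)<\varepsilon$ and $g=u$ pointwise in $C_\varepsilon$.
   Context: $\overline{\mathbb{R}}:=[-\infty,\infty]$ with its usual topology. A topological measure space is a quadruple $(X,\tau,\mathfrak{M},\mu)$ where $(X,\tau)$ is a topological space, $\mathfrak{M}$ is a $\sigma$-algebra of subsets of $X$ containing the Borel $\sigma$-algebra of $(X,\tau)$ (equality is not required), and $\mu:\mathfrak{M}\to[0,\infty]$ is a nonnegative measure. Measurable means with respect to $\mathfrak{M}$. The measure $\mu$ is strongly regular if for every $E\in\mathfrak{M}$, $\inf\{\mu(O\setminus C): C \text{ closed},\ O \text{ open},\ C\subseteq E\subseteq O\}=0$. The topological measure space is almost normal if, for every set $C\subseteq X$ closed in $\tau$, any function $f:C\to\overline{\mathbb{R}}$ continuous with respect to the subspace topology $\tau|_C$, and any $\varepsilon\in(0,\infty)$, there exist a set $C_\varepsilon\subseteq C$ closed in $\tau$ and a function $F_\varepsilon:X\to\overline{\mathbb{R}}$ continuous with respect to $\tau$ such that $\mu(C\setminus C_\varepsilon)<\varepsilon$ and $F_\varepsilon=f$ pointwise in $C_\varepsilon$.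 *)

theory Defs
  imports "HOL-Analysis.Analysis"
begin

text \<open>
  The topology and the measure are carried by the same, possibly proper, subset
  \<open>topspace T = space M\<close> of the ambient type. Functions on this subset are total functions on
  the type whose values off it are irrelevant.
\<close>

definition topological_measure_space :: "'a topology \<Rightarrow> 'a measure \<Rightarrow> bool" where
  "topological_measure_space T M \<longleftrightarrow>
     topspace T = space M \<and> sigma_sets (topspace T) {U. openin T U} \<subseteq> sets M"

definition strongly_regular :: "'a topology \<Rightarrow> 'a measure \<Rightarrow> bool" where
  "strongly_regular T M \<longleftrightarrow>
     (\<forall>E \<in> sets M.
        Inf {emeasure M (U - C) | C U. closedin T C \<and> openin T U \<and> C \<subseteq> E \<and> E \<subseteq> U} = 0)"

definition almost_normal :: "'a topology \<Rightarrow> 'a measure \<Rightarrow> bool" where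
  "almost_normal T M \<longleftrightarrow>
     (\<forall>C (f :: 'a \<Rightarrow> ereal) (\<epsilon> :: real).
        closedin T C \<longrightarrow> continuous_map (subtopology T C) euclidean f \<longrightarrow> 0 < \<epsilon> \<longrightarrow>
        (\<exists>C\<^sub>\<epsilon> (F\<^sub>\<epsilon> :: 'a \<Rightarrow> ereal).
           C\<^sub>\<epsilon> \<subseteq> C \<and> closedin T C\<^sub>\<epsilon> \<and> continuous_map T euclidean F\<^sub>\<epsilon> \<and>
           emeasure M (C - C\<^sub>\<epsilon>) < ennreal \<epsilon> \<and> (\<forall>x \<in> C\<^sub>\<epsilon>. F\<^sub>\<epsilon> x = f x)))"

definition strong_Lusin :: "'a topology \<Rightarrow> 'a measure \<Rightarrow> bool" where
  "strong_Lusin T M \<longleftrightarrow>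
     (\<forall>(u :: 'a \<Rightarrow> ereal) (\<epsilon> :: real).
        u \<in> borel_measurable M \<longrightarrow> 0 < \<epsilon> \<longrightarrow>
        (\<exists>C\<^sub>\<epsilon> (g :: 'a \<Rightarrow> ereal).
           closedin T C\<^sub>\<epsilon> \<and> continuous_map T euclidean g \<and>
           emeasure M (topspace T - C\<^sub>\<epsilon>) < ennreal \<epsilon> \<and> (\<forall>x \<in> C\<^sub>\<epsilon>. g x = u x)))"

end

theory Submission
  imports Defs
begin

text \<open>
  Strong regularity is Lusin's theorem without the extension. Choose closed and open sets
  \<open>C\<^sub>n \<subseteq> u\<^sup>-\<^sup>1(B\<^sub>n) \<subseteq> U\<^sub>n\<close> for a countable base \<open>(B\<^sub>n)\<close> of the codomain, with
  \<open>\<mu>(U\<^sub>n - C\<^sub>n)\<close> summing to less than \<open>\<epsilon>\<close>. Off the open set \<open>\<Union>\<^sub>n (U\<^sub>n - C\<^sub>n)\<close> the preimage of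
  \<open>B\<^sub>n\<close> coincides with \<open>U\<^sub>n\<close>, so there the restriction of \<open>u\<close> is continuous
  (\<open>strongly_regular_imp_continuous_restriction\<close>). Almost normality is exactly what is needed to
  extend this restriction to the whole space, after shrinking the closed set a little once more.

  Conversely, the strong Lusin property gives strong regularity when it is applied to indicator
  functions: outside a small open set the continuous approximant \<open>g\<close> of the indicator of \<open>E\<close>
  takes only the values 0 and 1, so there the closed set \<open>{g \<ge> 1}\<close>, the open set \<open>{g > 0}\<close> and
  \<open>E\<close> all agree (\<open>strong_Lusin_imp_strongly_regular\<close>). It gives almost
  normality when it is applied to the extension by zero of a continuous function on a closed set
  (\<open>strong_Lusin_imp_almost_normal\<close>).
\<close>

lemma topological_measure_space_sets:
  assumes "topological_measure_space T M"
  shows topological_measure_space_openin: "openin T U \<Longrightarrow> U \<in> sets M"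
    and topological_measure_space_closedin: "closedin T C \<Longrightarrow> C \<in> sets M"
proof -
  show op: "U \<in> sets M" if "openin T U" for U
    using assms that sigma_sets.Basic unfolding topological_measure_space_def by blast
  show "C \<in> sets M" if "closedin T C"
  proof -
    have "topspace T - C \<in> sets M"
      using that by (intro op) (simp add: closedin_def)
    then have "space M - (topspace T - C) \<in> sets M"
      by (rule sets.compl_sets)
    moreover have "space M - (topspace T - C) = C"
      using assms that closedin_subset[OF that] by (auto simp: topological_measure_space_def)
    ultimately show ?thesis by simp
  qed
qed

lemma strongly_regularE:
  assumes "strongly_regular T M" and "E \<in> sets M" and "0 < e"
  obtains C U where "closedin T C" "openin T U" "C \<subseteq> E" "E \<subseteq> U" "emeasure M (U - C) < e"
proof -
  have "Inf {emeasure M (U - C) | C U. closedin T C \<and> openin T U \<and> C \<subseteq> E \<and> E \<subseteq> U} < e"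
    using assms unfolding strongly_regular_def by auto
  then show ?thesis
    using that by (auto simp: Inf_less_iff)
qed

text \<open>
  Continuity need only be tested on a base of the codomain. When the base is countable, the
  approximation errors of the preimages of its members can be made to sum to less than \<open>\<epsilon>\<close>, and
  the union of the error sets is open, because each is the difference of an open and a closed set.
\<close>

lemma strongly_regular_imp_continuous_restriction:
  fixes u :: "'a \<Rightarrow> 'b::second_countable_topology" and \<epsilon> :: real
  assumes tms: "topological_measure_space T M" and reg: "strongly_regular T M"
    and u: "u \<in> borel_measurable M" and \<epsilon>: "0 < \<epsilon>"
  obtains C where "closedin T C" "emeasure M (topspace T - C) < ennreal \<epsilon>"
    "continuous_map (subtopology T C) euclidean u"
proof -
  have sp: "topspace T = space M"
    using tms by (simp add: topological_measure_space_def)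
  obtain \<B> :: "'b set set" where \<B>: "countable \<B>" "topological_basis \<B>"
    using ex_countable_basis by blast
  have ne: "\<B> \<noteq> {}"
    using topological_basisE[OF \<B>(2) open_UNIV UNIV_I] by blast
  define B where "B = from_nat_into \<B>"
  have rangeB: "range B = \<B>"
    unfolding B_def by (rule range_from_nat_into[OF ne \<B>(1)])
  define E where "E n = u -` B n \<inter> space M" for n
  define e where "e n = \<epsilon> / 2 * (1 / 2) ^ Suc n" for n :: nat
  have e_pos: "0 < e n" for n using \<epsilon> by (simp add: e_def)
  have "\<exists>C U. closedin T C \<and> openin T U \<and> C \<subseteq> E n \<and> E n \<subseteq> U
      \<and> emeasure M (U - C) < ennreal (e n)" for n
  proof -
    have "open (B n)" using topological_basis_open[OF \<B>(2)] rangeB by blast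
    then have "E n \<in> sets M" unfolding E_def by (intro measurable_sets[OF u]) simp
    then obtain C U where "closedin T C" "openin T U" "C \<subseteq> E n" "E n \<subseteq> U"
        "emeasure M (U - C) < ennreal (e n)"
      using e_pos[of n] by (rule_tac strongly_regularE[OF reg, of "E n" "ennreal (e n)"]) auto
    then show ?thesis by blast
  qed
  then have "\<forall>n. \<exists>C U. closedin T C \<and> openin T U \<and> C \<subseteq> E n \<and> E n \<subseteq> U
      \<and> emeasure M (U - C) < ennreal (e n)" by blast
  from this[unfolded choice_iff] obtain K U where KU: "\<And>n. closedin T (K n)" "\<And>n. openin T (U n)"
      "\<And>n. K n \<subseteq> E n" "\<And>n. E n \<subseteq> U n" "\<And>n. emeasure M (U n - K n) < ennreal (e n)"
    by blast
  define N where "N = (\<Union>n. U n - K n)"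
  have opUK: "openin T (U n - K n)" for n
    using KU by (simp add: openin_diff)
  have opN: "openin T N" unfolding N_def using opUK by blast
  have "emeasure M N \<le> (\<Sum>n. emeasure M (U n - K n))"
    unfolding N_def
    using topological_measure_space_openin[OF tms opUK] by (intro emeasure_subadditive_countably) blast
  also have "\<dots> \<le> (\<Sum>n. ennreal (e n))"
    by (intro suminf_le) (auto intro: less_imp_le KU)
  also have "\<dots> = ennreal (\<epsilon> / 2)"
  proof (rule suminf_ennreal_eq)
    show "e sums (\<epsilon> / 2)"
      using sums_mult[OF power_half_series, of "\<epsilon> / 2"] by (simp add: e_def[abs_def])
  qed (use e_pos less_imp_le in blast)
  also have "\<dots> < ennreal \<epsilon>" using \<epsilon> by (simp add: ennreal_lessI)
  finally have small: "emeasure M N < ennreal \<epsilon>" .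
  define C where "C = topspace T - N"
  have "openin (subtopology T C) {x \<in> topspace (subtopology T C). u x \<in> W}" if "open W" for W
  proof -
    have "\<exists>\<A>. \<A> \<subseteq> \<B> \<and> \<Union>\<A> = W"
      using \<B>(2) that by (simp add: topological_basis_def)
    then obtain \<A> where \<A>: "\<A> \<subseteq> \<B>" "\<Union>\<A> = W"
      by (elim exE conjE)
    have "{x \<in> topspace (subtopology T C). u x \<in> W} = C \<inter> \<Union>{U n | n. B n \<in> \<A>}"
      \<comment> \<open>A point of \<open>U n\<close> that is not in \<open>N\<close> must lie in \<open>K n\<close>, hence in \<open>E n\<close>.\<close>
    proof (intro equalityI subsetI)
      fix x assume x: "x \<in> {x \<in> topspace (subtopology T C). u x \<in> W}"
      then obtain A where "A \<in> \<A>" "u x \<in> A" using \<A>(2) by blast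
      moreover then obtain n where "A = B n" using \<A>(1) rangeB by blast
      ultimately have "x \<in> E n" "B n \<in> \<A>" using x sp by (auto simp: E_def)
      then show "x \<in> C \<inter> \<Union>{U n | n. B n \<in> \<A>}" using x KU(4) by auto
    next
      fix x assume "x \<in> C \<inter> \<Union>{U n | n. B n \<in> \<A>}"
      then obtain n where n: "x \<in> C" "x \<in> U n" "B n \<in> \<A>" by blast
      then have "x \<in> K n" by (auto simp: C_def N_def)
      then have "u x \<in> B n" using KU(3) by (auto simp: E_def)
      then show "x \<in> {x \<in> topspace (subtopology T C). u x \<in> W}"
        using n \<A>(2) by (auto simp: C_def)
    qed
    moreover have "openin T (\<Union>{U n | n. B n \<in> \<A>})" using KU(2) by blast
    ultimately show ?thesis by (auto simp: openin_subtopology_Int2)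
  qed
  then have "continuous_map (subtopology T C) euclidean u"
    by (auto simp: continuous_map_def)
  moreover have "closedin T C" unfolding C_def using opN by blast
  moreover have "topspace T - C = N" using openin_subset[OF opN] by (auto simp: C_def)
  ultimately show ?thesis using that small by simp
qed

lemma almost_normal_strongly_regular_imp_strong_Lusin:
  assumes tms: "topological_measure_space T M"
    and "almost_normal T M" and reg: "strongly_regular T M"
  shows "strong_Lusin T M"
  unfolding strong_Lusin_def
proof (intro allI impI)
  fix u :: "'a \<Rightarrow> ereal" and \<epsilon> :: real
  assume u: "u \<in> borel_measurable M" and \<epsilon>: "0 < \<epsilon>"
  obtain C where C: "closedin T C" "emeasure M (topspace T - C) < ennreal (\<epsilon> / 2)"
      "continuous_map (subtopology T C) euclidean u"
    using strongly_regular_imp_continuous_restriction[OF tms reg u, of "\<epsilon> / 2"] \<epsilon> by auto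
  obtain D g where D: "D \<subseteq> C" "closedin T D" "continuous_map T euclidean g"
      "emeasure M (C - D) < ennreal (\<epsilon> / 2)" "\<forall>x \<in> D. g x = u x"
    using assms(2) C(1,3) \<epsilon> unfolding almost_normal_def by (meson half_gt_zero)
  have "topspace T - D = (topspace T - C) \<union> (C - D)"
    using D(1) closedin_subset[OF C(1)] by blast
  moreover have "topspace T - C \<in> sets M" "C - D \<in> sets M"
    using topological_measure_space_sets[OF tms] C(1) D(2) by blast+
  ultimately have "emeasure M (topspace T - D) \<le> emeasure M (topspace T - C) + emeasure M (C - D)"
    by (simp add: emeasure_subadditive)
  also have "\<dots> < ennreal (\<epsilon> / 2) + ennreal (\<epsilon> / 2)"
    using C(2) D(4) by (rule add_strict_mono)
  also have "\<dots> = ennreal \<epsilon>" using \<epsilon> by (simp flip: ennreal_plus)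
  finally show "\<exists>D g. closedin T D \<and> continuous_map T euclidean g \<and>
      emeasure M (topspace T - D) < ennreal \<epsilon> \<and> (\<forall>x \<in> D. g x = u x)"
    using D by blast
qed

lemma strong_Lusin_imp_strongly_regular:
  assumes tms: "topological_measure_space T M" and lusin: "strong_Lusin T M"
  shows "strongly_regular T M"
  unfolding strongly_regular_def
proof
  fix E assume E: "E \<in> sets M"
  let ?A = "{emeasure M (U - C) | C U. closedin T C \<and> openin T U \<and> C \<subseteq> E \<and> E \<subseteq> U}"
  have sp: "topspace T = space M"
    using tms by (simp add: topological_measure_space_def)
  have le: "Inf ?A \<le> ennreal \<epsilon>" if \<epsilon>: "0 < \<epsilon>" for \<epsilon> :: real
  proof -
    have "(indicator E :: 'a \<Rightarrow> ereal) \<in> borel_measurable M" using E by simp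
    then obtain D and g :: "'a \<Rightarrow> ereal" where D: "closedin T D" "continuous_map T euclidean g"
        "emeasure M (topspace T - D) < ennreal \<epsilon>" "\<forall>x \<in> D. g x = indicator E x"
      using lusin \<epsilon> unfolding strong_Lusin_def by meson
    \<comment> \<open>Intersecting with \<open>D\<close> and adding its complement make the inclusions hold everywhere.\<close>
    define C where "C = D \<inter> {x \<in> topspace T. g x \<in> {1..}}"
    define U where "U = (topspace T - D) \<union> {x \<in> topspace T. g x \<in> {0<..}}"
    have "closedin T C" unfolding C_def
      using D(1) closedin_continuous_map_preimage[OF D(2), of "{1..}"] by auto
    moreover have "openin T U" unfolding U_def
      using D(1) openin_continuous_map_preimage[OF D(2), of "{0<..}"] by auto
    moreover have "C \<subseteq> E"
    proof
      fix x assume "x \<in> C"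
      then have "g x = indicator E x" "1 \<le> g x" using D(4) by (auto simp: C_def)
      then show "x \<in> E" by (cases "x \<in> E") auto
    qed
    moreover have "E \<subseteq> U"
    proof
      fix x assume "x \<in> E"
      then show "x \<in> U"
        using D(4) sets.sets_into_space[OF E] sp by (cases "x \<in> D") (auto simp: U_def)
    qed
    ultimately have "Inf ?A \<le> emeasure M (U - C)" by (intro Inf_lower) blast
    also have "\<dots> \<le> emeasure M (topspace T - D)"
    proof (rule emeasure_mono)
      show "U - C \<subseteq> topspace T - D"
      proof (intro subsetI, rule ccontr)
        fix x assume x: "x \<in> U - C" "x \<notin> topspace T - D"
        then have "x \<in> D" "0 < g x" "\<not> 1 \<le> g x" by (auto simp: U_def C_def)
        moreover from this have "g x = indicator E x" using D(4) by blast
        ultimately show False by (cases "x \<in> E") auto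
      qed
      show "topspace T - D \<in> sets M"
        using D(1) by (intro topological_measure_space_openin[OF tms]) blast
    qed
    finally show ?thesis using D(3) by simp
  qed
  have "Inf ?A \<le> 0" by (rule ennreal_le_epsilon) (simp add: le)
  then show "Inf ?A = 0" by simp
qed

lemma strong_Lusin_imp_almost_normal:
  assumes tms: "topological_measure_space T M" and lusin: "strong_Lusin T M"
  shows "almost_normal T M"
  unfolding almost_normal_def
proof (intro allI impI)
  fix C and f :: "'a \<Rightarrow> ereal" and \<epsilon> :: real
  assume C: "closedin T C" and f: "continuous_map (subtopology T C) euclidean f" and \<epsilon>: "0 < \<epsilon>"
  define u where "u x = (if x \<in> C then f x else 0)" for x
  have CM: "C \<in> sets M" using topological_measure_space_closedin[OF tms C] .
  have "u \<in> borel_measurable M"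
    unfolding u_def
  proof (rule measurable_If_restrict_space_iff[THEN iffD2], goal_cases)
    case 1
    then show ?case using CM by simp
  next
    case 2
    have "f \<in> borel_measurable (restrict_space M C)"
    proof (rule borel_measurableI)
      fix W :: "ereal set" assume "open W"
      then have "openin (subtopology T C) {x \<in> topspace (subtopology T C). f x \<in> W}"
        using openin_continuous_map_preimage[OF f] by simp
      moreover have "{x \<in> topspace (subtopology T C). f x \<in> W} = f -` W \<inter> space (restrict_space M C)"
        using tms by (auto simp: topological_measure_space_def space_restrict_space)
      ultimately obtain V where "openin T V" "f -` W \<inter> space (restrict_space M C) = V \<inter> C"
        by (auto simp: openin_subtopology)
      then show "f -` W \<inter> space (restrict_space M C) \<in> sets (restrict_space M C)"
        using topological_measure_space_openin[OF tms] by (auto simp: sets_restrict_space)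
    qed
    then show ?case using CM by simp
  qed
  then obtain D g where D: "closedin T D" "continuous_map T euclidean g"
      "emeasure M (topspace T - D) < ennreal \<epsilon>" "\<forall>x \<in> D. g x = u x"
    using lusin \<epsilon> unfolding strong_Lusin_def by meson
  have "emeasure M (C - C \<inter> D) \<le> emeasure M (topspace T - D)"
  proof (rule emeasure_mono)
    show "C - C \<inter> D \<subseteq> topspace T - D" using closedin_subset[OF C] by blast
    show "topspace T - D \<in> sets M"
      using D(1) by (intro topological_measure_space_openin[OF tms]) blast
  qed
  then have "emeasure M (C - C \<inter> D) < ennreal \<epsilon>" using D(3) by simp
  moreover have "closedin T (C \<inter> D)" using C D(1) by blast
  moreover have "\<forall>x \<in> C \<inter> D. g x = f x" using D(4) by (simp add: u_def)
  ultimately show "\<exists>D F. D \<subseteq> C \<and> closedin T D \<and> continuous_map T euclidean F \<and>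
      emeasure M (C - D) < ennreal \<epsilon> \<and> (\<forall>x \<in> D. F x = f x)"
    using D(2) by (meson Int_lower1)
qed

theorem theorem4p4:
  fixes T :: "'a topology" and M :: "'a measure"
  assumes "topological_measure_space T M"
  shows "(almost_normal T M \<and> strongly_regular T M) \<longleftrightarrow> strong_Lusin T M"
  using almost_normal_strongly_regular_imp_strong_Lusin[OF assms]
    strong_Lusin_imp_strongly_regular[OF assms] strong_Lusin_imp_almost_normal[OF assms]
  by blast

end
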